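(* Let $(X,d)$ be a metric space with a marked point $p\in X$. The following two statements are equivalent. (i) All pretangent spaces $(\Omega^X_{p,\tilde r},\rho)$ to $X$ at $p$ (for every normalizing sequence $\tilde r$ and every choice of maximal self-stable family $\tilde X_{p,\tilde r}$ containing $\tilde p$) are ultrametric. (ii) We have the limit relation $$\lim_{x,y,z\to p}\frac{s(x,y,z)}{\Phi(x,y,z)}\,\Psi(x,y,z)=\infty,$$ where $x,y,z$ range over $X$ and $\frac{1}{\Phi(x,y,z)}:=\infty$ if $\Phi(x,y,z)=0$.
   Context: Notation: $a\vee b=\max\{a,b\}$, $a\wedge b=\min\{a,b\}$. A metric space $(Y,\delta)$ is ultrametric if $\delta(x,y)\le \delta(x,z)\vee \delta(y,z)$ for all $x,y,z\in Y$. Pretangent spaces. A normalizing sequence is a sequence $\tilde r=\{r_n\}_{n\in\mathbb N}$ of positive reals with $r_n\to 0$. Let $\tilde X$ be the set of all sequences of points of $X$. Two sequences $\tilde x=\{x_n\},\tilde y=\{y_n\}\in\tilde X$ are mutually stable w.r.t. $\tilde r$ if the finite limit $\tilde d_{\tilde r}(\tilde x,\tilde y):=\lim_{n\to\infty} d(x_n,y_n)/r_n$ exists. A family $\tilde F\subseteq\tilde X$ is self-stable w.r.t. $\tilde r$ if every two of its elements are mutually stable; it is maximal self-stable if it is self-stable and for every $\tilde z\in\tilde X\setminus\tilde F$ there is $\tilde x\in\tilde F$ such that $\tilde x,\tilde z$ are not mutually stable. For $p\in X$, let $\tilde X_{p,\tilde r}$ be a maximal self-stable family containing the constant sequence $\tilde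 p=\{p,p,\dots\}$ (such a family exists, but need not be unique). Then $\tilde d_{\tilde r}$ is a pseudometric on $\tilde X_{p,\tilde r}$. The metric identification $(\Omega^X_{p,\tilde r},\rho)$, i.e. the set of equivalence classes under $\tilde x\sim\tilde y\Leftrightarrow \tilde d_{\tilde r}(\tilde x,\tilde y)=0$ with $\rho(\alpha,\beta)=\tilde d_{\tilde r}(\tilde x,\tilde y)$ for $\tilde x\in\alpha,\tilde y\in\beta$, is called a pretangent space to $X$ at $p$ w.r.t. $\tilde r$. The function $s$. For $x,y,z\in X$: if $d(x,z)\vee d(z,y)<d(x,y)$, then $s(x,y,z)$ is the unique solution $s_0\in[1,\infty)$ of the equation $(d(x,z))^{s}+(d(z,y))^{s}=(d(x,y))^{s}$; otherwise $s(x,y,z):=+\infty$. The functions $F,\Phi,\Psi$ (depending on $d$ and $p$). For $x,y\in X$ set $$F(x,y):=\frac{d(x,y)\,(d(x,p)\wedge d(y,p))}{(d(x,p)\vee d(y,p))^2}\ \text{ if }(x,y)\ne(p,p),\qquad F(p,p):=0.$$ For $x,y,z\in X$ set $\Phi(x,y,z):=F(x,y)\vee F(x,z)\vee F(y,z)$ and $$\Psi(x,y,z):=\frac{d(x,y)\vee d(y,z)\vee d(x,z)}{d(x,y)\wedge d(y,z)\wedge d(z,x)},$$ with $\Psi(x,y,z):=\infty$ if $d(x,y)\wedge d(y,z)\wedge d(z,x)=0$. The expression in (ii) is a product of three factors $s$, $1/\Phi$, $\Psi$ in $(0,\infty]$, hence is well defined in $(0,\infty]$. The limit relation means: for every $M>0$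 there is $\varepsilon>0$ such that the expression exceeds $M$ for all $x,y,z\in X$ with $d(x,p),d(y,p),d(z,p)<\varepsilon$. *)

theory Defs
  imports "HOL-Analysis.Analysis" "HOL-Real_Asymp.Real_Asymp"
begin

section \<open>Ultrametric spaces\<close>

definition ultrametric_space :: "'b set \<Rightarrow> ('b \<Rightarrow> 'b \<Rightarrow> real) \<Rightarrow> bool" where
  "ultrametric_space Y \<delta> \<longleftrightarrow>
     Metric_space Y \<delta> \<and> (\<forall>x\<in>Y. \<forall>y\<in>Y. \<forall>z\<in>Y. \<delta> x y \<le> max (\<delta> x z) (\<delta> y z))"


section \<open>Pretangent spaces\<close>

definition normalizing :: "(nat \<Rightarrow> real) \<Rightarrow> bool" where
  "normalizing r \<longleftrightarrow> (\<forall>n. r n > 0) \<and> r \<longlonglongrightarrow> 0"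

definition mutually_stable ::
  "(nat \<Rightarrow> real) \<Rightarrow> (nat \<Rightarrow> 'a::metric_space) \<Rightarrow> (nat \<Rightarrow> 'a) \<Rightarrow> bool" where
  "mutually_stable r x y \<longleftrightarrow> convergent (\<lambda>n. dist (x n) (y n) / r n)"

definition scaled_dist ::
  "(nat \<Rightarrow> real) \<Rightarrow> (nat \<Rightarrow> 'a::metric_space) \<Rightarrow> (nat \<Rightarrow> 'a) \<Rightarrow> real" where
  "scaled_dist r x y = lim (\<lambda>n. dist (x n) (y n) / r n)"

definition self_stable :: "(nat \<Rightarrow> real) \<Rightarrow> (nat \<Rightarrow> 'a::metric_space) set \<Rightarrow> bool" where
  "self_stable r F \<longleftrightarrow> (\<forall>x\<in>F. \<forall>y\<in>F. mutually_stable r x y)"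

definition maximal_self_stable ::
  "(nat \<Rightarrow> real) \<Rightarrow> (nat \<Rightarrow> 'a::metric_space) set \<Rightarrow> bool" where
  "maximal_self_stable r F \<longleftrightarrow>
     self_stable r F \<and> (\<forall>z. z \<notin> F \<longrightarrow> (\<exists>x\<in>F. \<not> mutually_stable r x z))"

definition pretangent_rel ::
  "(nat \<Rightarrow> real) \<Rightarrow> (nat \<Rightarrow> 'a::metric_space) set \<Rightarrow> (nat \<Rightarrow> 'a) rel" where
  "pretangent_rel r F = {(x, y). x \<in> F \<and> y \<in> F \<and> scaled_dist r x y = 0}"

definition pretangent_space ::
  "(nat \<Rightarrow> real) \<Rightarrow> (nat \<Rightarrow> 'a::metric_space) set \<Rightarrow> (nat \<Rightarrow> 'a) set set" where
  "pretangent_space r F = F // pretangent_rel r F"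

text \<open>The value 0 off the carrier is a convention: the locale \<^locale>\<open>Metric_space\<close> demands
  symmetry and nonnegativity on the whole type. On the carrier the description is
  well defined, see \<open>pretangent_dist_eq\<close> below.\<close>

definition pretangent_dist ::
  "(nat \<Rightarrow> real) \<Rightarrow> (nat \<Rightarrow> 'a::metric_space) set \<Rightarrow> (nat \<Rightarrow> 'a) set \<Rightarrow> (nat \<Rightarrow> 'a) set \<Rightarrow> real"
where
  "pretangent_dist r F \<alpha> \<beta> =
     (if \<alpha> \<in> pretangent_space r F \<and> \<beta> \<in> pretangent_space r F
      then (THE t. \<forall>x\<in>\<alpha>. \<forall>y\<in>\<beta>. scaled_dist r x y = t) else 0)"


section \<open>The functions s, F, \<open>\<Phi>\<close> and \<open>\<Psi>\<close>\<close>

text \<open>The solution below exists and is unique, see \<open>s_exponent_ex1\<close>.\<close>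

definition s_exponent :: "'a::metric_space \<Rightarrow> 'a \<Rightarrow> 'a \<Rightarrow> ereal" where
  "s_exponent x y z =
     (if max (dist x z) (dist z y) < dist x y
      then ereal (THE s. 1 \<le> s \<and> dist x z powr s + dist z y powr s = dist x y powr s)
      else \<infinity>)"

definition F_fun :: "'a::metric_space \<Rightarrow> 'a \<Rightarrow> 'a \<Rightarrow> real" where
  "F_fun p x y =
     (if (x, y) = (p, p) then 0
      else dist x y * min (dist x p) (dist y p) / (max (dist x p) (dist y p))\<^sup>2)"

definition Phi :: "'a::metric_space \<Rightarrow> 'a \<Rightarrow> 'a \<Rightarrow> 'a \<Rightarrow> real" where
  "Phi p x y z = max (F_fun p x y) (max (F_fun p x z) (F_fun p y z))"

definition Psi :: "'a::metric_space \<Rightarrow> 'a \<Rightarrow> 'a \<Rightarrow> ereal" where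
  "Psi x y z =
     (let m = min (dist x y) (min (dist y z) (dist z x))
      in if m = 0 then \<infinity> else ereal (max (dist x y) (max (dist y z) (dist x z)) / m))"

text \<open>In \<^typ>\<open>ereal\<close> one has \<open>1 / 0 = \<infinity>\<close>, which is the required convention for \<open>1 / \<Phi>\<close>
  when \<open>\<Phi>\<close> vanishes.\<close>

definition s_Phi_Psi :: "'a::metric_space \<Rightarrow> 'a \<Rightarrow> 'a \<Rightarrow> 'a \<Rightarrow> ereal" where
  "s_Phi_Psi p x y z = s_exponent x y z * (1 / ereal (Phi p x y z)) * Psi x y z"


section \<open>Well-definedness\<close>

lemma scaled_dist_tendsto:
  "self_stable r F \<Longrightarrow> x \<in> F \<Longrightarrow> y \<in> F \<Longrightarrow>
    (\<lambda>n. dist (x n) (y n) / r n) \<longlonglongrightarrow> scaled_dist r x y"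
  unfolding self_stable_def mutually_stable_def scaled_dist_def convergent_LIMSEQ_iff by blast

lemma scaled_dist_commute: "scaled_dist r x y = scaled_dist r y x"
  by (simp add: scaled_dist_def dist_commute)

lemma scaled_dist_refl: "scaled_dist r x x = 0"
  by (simp add: scaled_dist_def limI)

lemma scaled_dist_nonneg:
  assumes "normalizing r" "self_stable r F" "x \<in> F" "y \<in> F"
  shows "0 \<le> scaled_dist r x y"
proof (rule LIMSEQ_le_const[OF scaled_dist_tendsto[OF assms(2-4)]])
  show "\<exists>N. \<forall>n\<ge>N. 0 \<le> dist (x n) (y n) / r n"
    using assms(1) by (auto simp: normalizing_def less_imp_le)
qed

lemma scaled_dist_triangle:
  assumes "normalizing r" "self_stable r F" "x \<in> F" "y \<in> F" "z \<in> F"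
  shows "scaled_dist r x z \<le> scaled_dist r x y + scaled_dist r y z"
proof (rule LIMSEQ_le[OF scaled_dist_tendsto[OF assms(2,3,5)]
      tendsto_add[OF scaled_dist_tendsto[OF assms(2,3,4)] scaled_dist_tendsto[OF assms(2,4,5)]]])
  have "dist (x n) (z n) / r n \<le> dist (x n) (y n) / r n + dist (y n) (z n) / r n" for n
    using assms(1) unfolding add_divide_distrib[symmetric]
    by (intro divide_right_mono dist_triangle) (simp add: normalizing_def less_imp_le)
  then show "\<exists>N. \<forall>n\<ge>N. dist (x n) (z n) / r n
      \<le> dist (x n) (y n) / r n + dist (y n) (z n) / r n" by blast
qed

lemma equiv_pretangent_rel:
  assumes "normalizing r" "self_stable r F"
  shows "equiv F (pretangent_rel r F)"
proof (rule equivI)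
  show "pretangent_rel r F \<subseteq> F \<times> F" "refl_on F (pretangent_rel r F)"
    by (auto simp: refl_on_def pretangent_rel_def scaled_dist_refl)
  show "sym (pretangent_rel r F)"
    by (auto simp: sym_def pretangent_rel_def scaled_dist_commute)
  show "trans (pretangent_rel r F)"
  proof (rule transI)
    fix x y z assume "(x, y) \<in> pretangent_rel r F" "(y, z) \<in> pretangent_rel r F"
    then show "(x, z) \<in> pretangent_rel r F"
      using scaled_dist_triangle[OF assms, of x y z] scaled_dist_nonneg[OF assms, of x z]
      by (auto simp: pretangent_rel_def)
  qed
qed

lemma pretangent_dist_eq:
  assumes nr: "normalizing r" and st: "self_stable r F"
    and ab: "\<alpha> \<in> pretangent_space r F" "\<beta> \<in> pretangent_space r F"
    and xy: "x \<in> \<alpha>" "y \<in> \<beta>"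
  shows "pretangent_dist r F \<alpha> \<beta> = scaled_dist r x y"
proof -
  note eq = equiv_pretangent_rel[OF nr st]
  note tri = scaled_dist_triangle[OF nr st]
  have rel: "(u, v) \<in> pretangent_rel r F" if "\<gamma> \<in> pretangent_space r F" "u \<in> \<gamma>" "v \<in> \<gamma>" for \<gamma> u v
    using quotient_eq_iff[OF eq, of \<gamma> \<gamma> u v] that by (simp add: pretangent_space_def)
  have le: "scaled_dist r u v \<le> scaled_dist r u' v'"
    if "u \<in> \<alpha>" "u' \<in> \<alpha>" "v \<in> \<beta>" "v' \<in> \<beta>" for u u' v v'
    using rel[OF ab(1) that(1,2)] rel[OF ab(2) that(4,3)] tri[of u u' v] tri[of u' v' v]
    by (auto simp: pretangent_rel_def)
  have "(THE t. \<forall>u\<in>\<alpha>. \<forall>v\<in>\<beta>. scaled_dist r u v = t) = scaled_dist r x y"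
  proof (rule the_equality)
    show "\<forall>u\<in>\<alpha>. \<forall>v\<in>\<beta>. scaled_dist r u v = scaled_dist r x y"
      by (intro ballI order.antisym le) (rule xy | assumption)+
  qed (use xy in auto)
  then show ?thesis using ab by (simp add: pretangent_dist_def)
qed

lemma Metric_space_pretangent:
  assumes nr: "normalizing r" and st: "self_stable r F"
  shows "Metric_space (pretangent_space r F) (pretangent_dist r F)"
proof -
  note eq = equiv_pretangent_rel[OF nr st]
  note val = pretangent_dist_eq[OF nr st]
  have rep: "\<exists>x. x \<in> \<alpha> \<and> x \<in> F" if "\<alpha> \<in> pretangent_space r F" for \<alpha>
    using in_quotient_imp_non_empty[OF eq, of \<alpha>] in_quotient_imp_subset[OF eq, of \<alpha>] that
    unfolding pretangent_space_def by blast
  show ?thesis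
  proof
    fix \<alpha> \<beta>
    show "0 \<le> pretangent_dist r F \<alpha> \<beta>"
    proof (cases "\<alpha> \<in> pretangent_space r F \<and> \<beta> \<in> pretangent_space r F")
      case True
      then obtain x y where "x \<in> \<alpha>" "x \<in> F" "y \<in> \<beta>" "y \<in> F" using rep[of \<alpha>] rep[of \<beta>] by blast
      then show ?thesis using True val[of \<alpha> \<beta> x y] scaled_dist_nonneg[OF nr st, of x y] by simp
    qed (auto simp: pretangent_dist_def)
    show "pretangent_dist r F \<alpha> \<beta> = pretangent_dist r F \<beta> \<alpha>"
    proof (cases "\<alpha> \<in> pretangent_space r F \<and> \<beta> \<in> pretangent_space r F")
      case True
      then obtain x y where "x \<in> \<alpha>" "y \<in> \<beta>" using rep[of \<alpha>] rep[of \<beta>] by blast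
      then show ?thesis
        using True val[of \<alpha> \<beta> x y] val[of \<beta> \<alpha> y x] scaled_dist_commute[of r x y] by simp
    qed (auto simp: pretangent_dist_def)
  next
    fix \<alpha> \<beta> assume a: "\<alpha> \<in> pretangent_space r F" and b: "\<beta> \<in> pretangent_space r F"
    obtain x y where x: "x \<in> \<alpha>" "x \<in> F" and y: "y \<in> \<beta>" "y \<in> F" using rep[OF a] rep[OF b] by blast
    have "\<alpha> = \<beta> \<longleftrightarrow> (x, y) \<in> pretangent_rel r F"
      using a b unfolding pretangent_space_def
      by (rule quotient_eq_iff[OF eq _ _ x(1) y(1)])
    then show "pretangent_dist r F \<alpha> \<beta> = 0 \<longleftrightarrow> \<alpha> = \<beta>"
      using val[OF a b x(1) y(1)] x y by (simp add: pretangent_rel_def)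
  next
    fix \<alpha> \<beta> \<gamma>
    assume abc: "\<alpha> \<in> pretangent_space r F" "\<beta> \<in> pretangent_space r F" "\<gamma> \<in> pretangent_space r F"
    then obtain x y z where "x \<in> \<alpha>" "x \<in> F" "y \<in> \<beta>" "y \<in> F" "z \<in> \<gamma>" "z \<in> F"
      using rep[of \<alpha>] rep[of \<beta>] rep[of \<gamma>] by blast
    then show "pretangent_dist r F \<alpha> \<gamma> \<le> pretangent_dist r F \<alpha> \<beta> + pretangent_dist r F \<beta> \<gamma>"
      using abc scaled_dist_triangle[OF nr st, of x y z]
        val[of \<alpha> \<gamma> x z] val[of \<alpha> \<beta> x y] val[of \<beta> \<gamma> y z] by simp
  qed
qed

lemma s_exponent_ex1:
  fixes x y z :: "'a::metric_space"
  assumes lt: "max (dist x z) (dist z y) < dist x y"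
  shows "\<exists>!s. 1 \<le> s \<and> dist x z powr s + dist z y powr s = dist x y powr s"
proof -
  define a b where "a = dist x z / dist x y" and "b = dist z y / dist x y"
  have c: "dist x y > 0" 
  proof -
    have "0 \<le> dist x z" by simp
    with lt show ?thesis by linarith
  qed
  have pos: "dist x z > 0" "dist z y > 0" using lt dist_triangle[of x y z] by linarith+
  have ab: "0 < a" "a < 1" "0 < b" "b < 1" using lt c pos by (auto simp: a_def b_def)
  have iff: "dist x z powr s + dist z y powr s = dist x y powr s \<longleftrightarrow> a powr s + b powr s = 1" for s
    using c pos by (auto simp: a_def b_def powr_divide field_simps)
  define h where "h = (\<lambda>s::real. a powr s + b powr s)"
  have dec: "h t < h s" if "s < t" for s t
    using that ab unfolding h_def by (intro add_strict_mono powr_less_mono') auto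
  have "((\<lambda>s. a powr s + b powr s) \<longlongrightarrow> 0 + 0) at_top"
    using ab by (intro tendsto_add) real_asymp+
  then have "eventually (\<lambda>s. h s < 1) at_top"
    unfolding h_def by (auto dest!: order_tendstoD(2)[where a = 1])
  then have "eventually (\<lambda>s. h s < 1 \<and> s \<ge> 1) at_top"
    using eventually_ge_at_top eventually_conj by blast
  then obtain t where t: "h t < 1" "t \<ge> 1"
    using eventually_happens by fastforce
  have h1: "h 1 \<ge> 1"
    using ab c dist_triangle[of x y z] by (simp add: h_def a_def b_def divide_simps)
  have "\<exists>s\<ge>1. s \<le> t \<and> h s = 1"
    by (rule IVT2') (use t h1 ab in \<open>auto simp: h_def intro!: continuous_intros\<close>)
  then obtain s where s: "s \<ge> 1" "h s = 1" by blast
  show ?thesis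
    unfolding iff
  proof (intro ex1I[of _ s] conjI)
    fix u assume "1 \<le> u \<and> a powr u + b powr u = 1"
    then show "u = s" using s dec[of u s] dec[of s u] unfolding h_def by linarith
  qed (use s in \<open>simp_all add: h_def\<close>)
qed

end

theory Submission
  imports Defs
begin

text \<open>Each factor of the product measures one way in which a triple close to \<open>p\<close> can fail to
  produce, after rescaling by \<open>d(x, y)\<close>, a pretangent space violating the strong triangle
  inequality. A bounded \<open>\<Psi>\<close> says that no side is negligible against another; given that,
  a bounded \<open>s\<close> says that \<open>d(x, y)\<close> exceeds the other two sides by a fixed factor, since a root
  of \<open>a\<^sup>s + b\<^sup>s = 1\<close> with \<open>a, b < 1\<close> is large precisely when \<open>max a b\<close> is close to 1; and
  \<open>\<Phi>\<close> bounded away from 0 forces \<open>p\<close> to lie within a fixed multiple of \<open>d(x, y)\<close>, so that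
  the triple and \<open>p\<close> remain at finite distance in the limit. As all three factors are bounded
  below by positive constants, the product is bounded if and only if each factor is.

  If the limit relation fails, there are triples tending to \<open>p\<close> with bounded product. By
  \<open>bounded_product_imp_scalene\<close>, rescaling by \<open>d(x, y)\<close> keeps all six distances among
  \<open>x, y, z, p\<close> bounded, with the two shorter sides at most \<open>q < 1\<close>. Compactness
  (\<open>self_stable_subsequence\<close>) makes the four sequences self-stable along a subsequence, Zorn's lemma
  (\<open>maximal_self_stable_extension\<close>) puts them in a maximal family, and the resulting pretangent space
  contains a triangle with sides \<open>1\<close>, \<open>\<le> q\<close>, \<open>\<le> q\<close>.

  Conversely, if three sequences of a self-stable family violate the strong triangle inequality,
  the limits of their mutual distances are positive, hence \<open>s\<close> and \<open>\<Psi>\<close> are eventually bounded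
  on them (\<open>scalene_imp_bounded_product\<close>). At most one of the three can be at limit distance 0
  from \<open>p\<close>; for the other two \<open>F\<close> has a positive limit, so \<open>\<Phi>\<close> is bounded away from 0
  (\<open>Phi_eventually_ge\<close>). The product then stays bounded along triples tending to \<open>p\<close>.\<close>

section \<open>The three factors\<close>

lemma F_fun_bounds: "0 \<le> F_fun p x y" "F_fun p x y \<le> 2"
proof -
  let ?R = "max (dist x p) (dist y p)" and ?m = "min (dist x p) (dist y p)"
  show "0 \<le> F_fun p x y"
    by (simp add: F_fun_def)
  show "F_fun p x y \<le> 2"
  proof (cases "x = p \<and> y = p")
    case False
    then have R: "?R > 0" by (auto simp: less_max_iff_disj)
    have "dist x y \<le> 2 * ?R"
      using dist_triangle2[of x y p] by linarith
    then have "dist x y * ?m \<le> (2 * ?R) * ?R"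
      by (intro mult_mono) (auto simp: le_max_iff_disj)
    then show ?thesis
      using False R by (simp add: F_fun_def divide_le_eq power2_eq_square)
  qed (simp add: F_fun_def)
qed

text \<open>Writing \<open>R\<close> for the larger distance to \<open>p\<close>, the definition gives
  \<open>F \<le> d(x, y) / R\<close>, because the smaller distance to \<open>p\<close> is at most \<open>R\<close>.\<close>

lemma F_fun_ge_imp_dist_le:
  assumes M: "M > 0" and F: "1 / M \<le> F_fun p x y"
  shows "dist x p \<le> M * dist x y" "dist y p \<le> M * dist x y"
proof -
  let ?R = "max (dist x p) (dist y p)" and ?m = "min (dist x p) (dist y p)"
  have ne: "\<not> (x = p \<and> y = p)"
    using M F by (auto simp: F_fun_def zero_less_divide_iff not_le)
  then have R: "?R > 0" by (auto simp: less_max_iff_disj)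
  have "1 / M \<le> dist x y * ?m / ?R\<^sup>2"
    using F ne by (auto simp: F_fun_def)
  also have "\<dots> \<le> dist x y * ?R / ?R\<^sup>2"
    by (intro divide_right_mono mult_left_mono) auto
  also have "\<dots> = dist x y / ?R"
    using R by (simp add: power2_eq_square)
  finally have "?R \<le> M * dist x y"
    using M R by (simp add: field_simps)
  then show "dist x p \<le> M * dist x y" "dist y p \<le> M * dist x y"
    by auto
qed

lemma Phi_le_2: "Phi p x y z \<le> 2"
  by (simp add: Phi_def F_fun_bounds)

lemma Phi_nonneg: "0 \<le> Phi p x y z"
  by (simp add: Phi_def F_fun_bounds le_max_iff_disj)

lemma s_exponentE:
  assumes "max (dist x z) (dist z y) < dist x y"
  obtains s where "s_exponent x y z = ereal s" "1 \<le> s"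
    "dist x z powr s + dist z y powr s = dist x y powr s"
  using theI'[OF s_exponent_ex1[OF assms]] that assms
  by (auto simp: s_exponent_def)

lemma s_exponent_ge_1: "1 \<le> s_exponent x y z"
proof (cases "max (dist x z) (dist z y) < dist x y")
  case True
  then show ?thesis by (rule s_exponentE) (simp add: one_ereal_def)
qed (simp add: s_exponent_def del: max_less_iff_conj)

lemma Psi_ge_1: "1 \<le> Psi x y z"
proof (cases "min (dist x y) (min (dist y z) (dist z x)) = 0")
  case False
  moreover have "0 \<le> min (dist x y) (min (dist y z) (dist z x))" by simp
  ultimately have pos: "0 < min (dist x y) (min (dist y z) (dist z x))" by linarith
  have "min (dist x y) (min (dist y z) (dist z x)) \<le> max (dist x y) (max (dist y z) (dist x z))"
    by auto
  with pos have "1 \<le> max (dist x y) (max (dist y z) (dist x z)) /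
      min (dist x y) (min (dist y z) (dist z x))"
    by (simp add: le_divide_eq)
  with False show ?thesis by (simp add: Psi_def Let_def one_ereal_def del: min_less_iff_conj)
qed (simp add: Psi_def)

lemma inverse_Phi_ge: "ereal (1 / 2) \<le> 1 / ereal (Phi p x y z)"
proof (cases "Phi p x y z = 0")
  case False
  then have "0 < Phi p x y z" using Phi_nonneg[of p x y z] by linarith
  then have "1 / 2 \<le> 1 / Phi p x y z"
    using Phi_le_2[of p x y z] by (intro divide_left_mono) auto
  with False show ?thesis by (simp add: one_ereal_def)
qed (simp add: zero_ereal_def[symmetric] divide_ereal_def)

text \<open>The other two factors are at least \<open>1\<close> or \<open>1 / 2\<close>, so a bound on the product bounds each
  factor; in particular no factor is infinite.\<close>

lemma factor_bounds:
  assumes "s_Phi_Psi p x y z \<le> ereal M"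
  shows "s_exponent x y z \<le> ereal (2 * M)" "Psi x y z \<le> ereal (2 * M)"
    "1 / ereal (Phi p x y z) \<le> ereal M"
proof -
  note ge = s_exponent_ge_1[of x y z] inverse_Phi_ge[of p x y z] Psi_ge_1[of x y z]
  have half: "t \<le> ereal (2 * M)" if "t * ereal (1 / 2) \<le> ereal M" for t
    using that by (cases t) auto
  have nn: "0 \<le> s_exponent x y z" "0 \<le> Psi x y z" "0 \<le> 1 / ereal (Phi p x y z)"
    using ge by (auto intro: order_trans[of _ "1::ereal"] order_trans[of _ "ereal (1/2)"])
  have "s_exponent x y z * ereal (1 / 2) * 1 \<le> s_Phi_Psi p x y z"
    unfolding s_Phi_Psi_def using ge nn by (intro ereal_mult_mono) auto
  with assms show "s_exponent x y z \<le> ereal (2 * M)"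
    by (intro half) (auto intro: order_trans)
  have "1 * ereal (1 / 2) * Psi x y z \<le> s_Phi_Psi p x y z"
    unfolding s_Phi_Psi_def using ge nn by (intro ereal_mult_mono) auto
  with assms show "Psi x y z \<le> ereal (2 * M)"
    by (intro half) (auto intro: order_trans simp: mult.commute)
  have "1 * (1 / ereal (Phi p x y z)) * 1 \<le> s_Phi_Psi p x y z"
    unfolding s_Phi_Psi_def using ge nn by (intro ereal_mult_mono) auto
  with assms show "1 / ereal (Phi p x y z) \<le> ereal M"
    by (auto intro: order_trans)
qed

lemma Psi_le_imp_dist_le:
  assumes "Psi x y z \<le> ereal K"
  shows "dist x z > 0" "dist z y > 0" "dist x y \<le> K * dist x z" "dist x y \<le> K * dist z y"
proof -
  let ?m = "min (dist x y) (min (dist y z) (dist z x))"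
  let ?D = "max (dist x y) (max (dist y z) (dist x z))"
  have ne: "?m \<noteq> 0" and le: "?D / ?m \<le> K"
    using assms by (auto simp: Psi_def Let_def split: if_splits)
  moreover have "0 \<le> ?m" by simp
  ultimately have m: "?m > 0" by linarith
  then show "dist x z > 0" "dist z y > 0" by (auto simp: dist_commute)
  have D: "?D \<le> K * ?m" using le m by (simp add: divide_le_eq)
  moreover have "dist x y \<le> ?D" by simp
  ultimately have xy: "dist x y \<le> K * ?m" by linarith
  have "0 \<le> ?D" by (simp add: le_max_iff_disj)
  with le m have "0 \<le> K" by (meson divide_nonneg_pos order_trans)
  then have "K * ?m \<le> K * dist x z" "K * ?m \<le> K * dist z y"
    by (auto intro!: mult_left_mono simp: dist_commute)
  with xy show "dist x y \<le> K * dist x z" "dist x y \<le> K * dist z y" by linarith+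
qed

text \<open>The maximum \<open>\<Phi>\<close> only controls one pair, which lies within \<open>M d(x, y)\<close> of \<open>p\<close>. Since
  \<open>d(x, y)\<close> is the diameter of the triple, the remaining point is at most \<open>d(x, y)\<close> farther away.\<close>

lemma inverse_Phi_le_imp_dist_le:
  assumes "1 / ereal (Phi p x y z) \<le> ereal M"
    and "dist x z \<le> dist x y" "dist z y \<le> dist x y"
  shows "dist x p \<le> (M + 1) * dist x y" "dist y p \<le> (M + 1) * dist x y"
    "dist z p \<le> (M + 1) * dist x y"
proof -
  have ne: "Phi p x y z \<noteq> 0"
    using assms(1) by (auto simp: zero_ereal_def[symmetric] divide_ereal_def)
  then have pos: "0 < Phi p x y z" using Phi_nonneg[of p x y z] by linarith
  have le: "1 / Phi p x y z \<le> M"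
    using assms(1) ne by (simp add: one_ereal_def)
  have "0 < 1 / Phi p x y z" using pos by simp
  with le have M: "0 < M" by linarith
  have "1 / M \<le> Phi p x y z"
    using le pos M by (simp add: field_simps)
  then consider "1 / M \<le> F_fun p x y" | "1 / M \<le> F_fun p x z" | "1 / M \<le> F_fun p y z"
    unfolding Phi_def le_max_iff_disj by blast
  then obtain u v where uv: "{u, v} \<subseteq> {x, y, z}" "1 / M \<le> F_fun p u v"
    by cases blast+
  have diam: "dist a b \<le> dist x y" if "{a, b} \<subseteq> {x, y, z}" for a b
    using that assms(2,3) by (auto simp: dist_commute)
  have "M * dist u v \<le> M * dist x y"
    using M diam[OF uv(1)] by (intro mult_left_mono) auto
  then have up: "dist u p \<le> M * dist x y"
    using F_fun_ge_imp_dist_le(1)[OF M uv(2)] by linarith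
  have "dist a p \<le> (M + 1) * dist x y" if "a \<in> {x, y, z}" for a
    using dist_triangle[of a p u] diam[of a u] up that uv(1) by (auto simp: algebra_simps)
  then show "dist x p \<le> (M + 1) * dist x y" "dist y p \<le> (M + 1) * dist x y"
    "dist z p \<le> (M + 1) * dist x y" by auto
qed

text \<open>With \<open>b\<close> bounded below and \<open>s\<close> bounded above, \<open>b\<^sup>s\<close> takes at least a fixed share of the sum 1,
  which keeps \<open>a\<close> uniformly away from 1. Powers of bases at most 1 do not increase with the exponent, so both
  estimates may pass from \<open>s\<close> to \<open>S\<close>.\<close>

lemma powr_le_of_powr_sum_eq_1:
  fixes a b c S s :: real
  assumes "0 < c" "c \<le> b" "b \<le> 1" "0 < a" "a \<le> 1" "0 < s" "s \<le> S" "a powr s + b powr s = 1"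
  shows "a \<le> (1 - c powr S) powr (1 / S)"
proof -
  have "c powr S \<le> b powr S" using assms by (intro powr_mono2) auto
  also have "\<dots> \<le> b powr s" using assms by (intro powr_mono') auto
  finally have "a powr s \<le> 1 - c powr S" using assms(8) by linarith
  moreover have "a powr S \<le> a powr s" using assms by (intro powr_mono') auto
  ultimately have "a powr S \<le> 1 - c powr S" by linarith
  then have "(a powr S) powr (1 / S) \<le> (1 - c powr S) powr (1 / S)"
    using assms by (intro powr_mono2) auto
  then show ?thesis using assms by (simp add: powr_powr)
qed

text \<open>The sum is at most \<open>2 q\<^sup>s\<close>, and this drops below 1 once \<open>s\<close> exceeds the stated bound.\<close>

lemma exponent_le_of_powr_sum_eq_1:
  fixes a b q s :: real
  assumes "0 < a" "a \<le> q" "0 < b" "b \<le> q" "q < 1" "1 \<le> s" "a powr s + b powr s = 1"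
  shows "s \<le> ln 2 / - ln q"
proof -
  have q: "0 < q" using assms by linarith
  have "a powr s \<le> q powr s" "b powr s \<le> q powr s"
    using assms by (auto intro!: powr_mono2)
  then have "1 / 2 \<le> q powr s" using assms(7) by linarith
  then have "ln (1 / 2) \<le> ln (q powr s)" using q by (subst ln_le_cancel_iff) auto
  then have "- ln 2 \<le> s * ln q" using q by (simp add: ln_powr ln_div)
  moreover have "ln q < 0" using q assms by (simp add: ln_less_zero)
  ultimately show ?thesis by (simp add: field_simps)
qed

lemma powr_equation_normalize:
  fixes a b c s :: real
  assumes "0 \<le> a" "0 \<le> b" "0 < c" "a powr s + b powr s = c powr s"
  shows "(a / c) powr s + (b / c) powr s = 1"
proof -
  have "(a / c) powr s + (b / c) powr s = (a powr s + b powr s) / c powr s"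
    using assms(1-3) by (simp add: powr_divide add_divide_distrib)
  also have "\<dots> = 1" unfolding assms(4) using assms(3) by simp
  finally show ?thesis .
qed

section \<open>Triangles on which the product is bounded\<close>

text \<open>The essential point is uniformity: \<open>q\<close> depends on \<open>M\<close> alone, not on the triple or the scale,
  so the strict gap between the longest side and the others survives passage to a limit. It is found
  by applying \<open>powr_le_of_powr_sum_eq_1\<close> to the two shorter sides relative to \<open>d(x, y)\<close>.\<close>

lemma bounded_product_imp_scalene:
  fixes M :: real
  obtains q where "q < 1"
    "\<And>p x y z :: 'a::metric_space. s_Phi_Psi p x y z \<le> ereal M \<Longrightarrow>
      0 < dist x y \<and> dist x z \<le> q * dist x y \<and> dist z y \<le> q * dist x y \<and>
      dist x p \<le> (M + 1) * dist x y \<and> dist y p \<le> (M + 1) * dist x y \<and>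
      dist z p \<le> (M + 1) * dist x y"
proof
  \<comment> \<open>\<open>2 * M\<close> bounds \<open>s\<close> and \<open>\<Psi>\<close>; the maximum keeps the base \<open>1 - c powr K\<close> nonnegative when
    \<open>2 * M < 1\<close>, where there is no such triple.\<close>
  define K where "K = max 1 (2 * M)"
  define c where "c = 1 / K"
  define q where "q = (1 - c powr K) powr (1 / K)"
  have K: "1 \<le> K" "2 * M \<le> K" by (auto simp: K_def)
  then have c: "0 < c" "c \<le> 1" by (auto simp: c_def)
  have "c powr K \<le> 1" using c K by (intro powr_le1) auto
  then have "q < 1 powr (1 / K)"
    unfolding q_def using K c by (intro powr_less_mono2) auto
  then show "q < 1" by simp
  fix p x y z :: 'a
  assume le: "s_Phi_Psi p x y z \<le> ereal M"
  note fb = factor_bounds[OF le]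
  have mx: "max (dist x z) (dist z y) < dist x y"
    using fb(1) by (auto simp: s_exponent_def split: if_splits)
  have pos: "0 < dist x z" "0 < dist z y" "dist x y \<le> K * dist x z" "dist x y \<le> K * dist z y"
    by (rule Psi_le_imp_dist_le[of x y z K], rule order_trans[OF fb(2)], use K in simp)+
  have xy: "0 < dist x y" using mx pos by linarith
  obtain s where s: "s_exponent x y z = ereal s" "1 \<le> s"
    "dist x z powr s + dist z y powr s = dist x y powr s"
    by (rule s_exponentE[OF mx])
  then have s2: "s \<le> K" using fb(1) K(2) by simp
  define a b where "a = dist x z / dist x y" and "b = dist z y / dist x y"
  have eq: "a powr s + b powr s = 1"
    unfolding a_def b_def using s(3) xy by (intro powr_equation_normalize) auto
  have ab: "0 < a" "a \<le> 1" "0 < b" "b \<le> 1" "c \<le> a" "c \<le> b"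
    using pos xy mx K by (auto simp: a_def b_def c_def field_simps)
  have "a \<le> q"
    unfolding q_def using ab c s(2) s2 eq
    by (intro powr_le_of_powr_sum_eq_1[where b = b and s = s]) auto
  moreover have "b \<le> q"
    unfolding q_def using ab c s(2) s2 eq
    by (intro powr_le_of_powr_sum_eq_1[where b = a and s = s]) auto
  ultimately have "dist x z \<le> q * dist x y" "dist z y \<le> q * dist x y"
    using xy by (auto simp: a_def b_def divide_le_eq)
  moreover have "dist x p \<le> (M + 1) * dist x y" "dist y p \<le> (M + 1) * dist x y"
    "dist z p \<le> (M + 1) * dist x y"
    by (rule inverse_Phi_le_imp_dist_le[OF fb(3)]; use mx in simp)+
  ultimately show "0 < dist x y \<and> dist x z \<le> q * dist x y \<and> dist z y \<le> q * dist x y \<and>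
      dist x p \<le> (M + 1) * dist x y \<and> dist y p \<le> (M + 1) * dist x y \<and>
      dist z p \<le> (M + 1) * dist x y"
    using xy by blast
qed

text \<open>A quantitative converse to \<open>bounded_product_imp_scalene\<close>. Its hypotheses are inequalities
  between distances that hold eventually along sequences as soon as they hold strictly for
  the limits of the rescaled distances.\<close>

lemma scalene_imp_bounded_product:
  assumes q: "q < 1" and c: "0 < c" and K: "0 < K"
    and pos: "0 < dist x z" "0 < dist z y"
    and le: "dist x z \<le> q * dist x y" "dist z y \<le> q * dist x y"
    and ge: "dist x y \<le> K * dist x z" "dist x y \<le> K * dist z y"
    and Phi: "c \<le> Phi p x y z"
  shows "s_Phi_Psi p x y z \<le> ereal (ln 2 / - ln q * (1 / c) * K)"
proof -
  have xy: "0 < dist x y"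
    using le(1) pos(1) by (cases "dist x y = 0") auto
  have "q * dist x y < dist x y" using q xy by simp
  then have mx: "max (dist x z) (dist z y) < dist x y" using le by linarith
  obtain s where s: "s_exponent x y z = ereal s" "1 \<le> s"
    "dist x z powr s + dist z y powr s = dist x y powr s"
    by (rule s_exponentE[OF mx])
  have "(dist x z / dist x y) powr s + (dist z y / dist x y) powr s = 1"
    using s(3) xy by (intro powr_equation_normalize) auto
  then have s_le: "s \<le> ln 2 / - ln q"
    using pos xy le q s(2)
    by (intro exponent_le_of_powr_sum_eq_1[of "dist x z / dist x y" q "dist z y / dist x y"])
      (auto simp: divide_le_eq)
  have Phi0: "0 < Phi p x y z" using c Phi by linarith
  have P: "1 / Phi p x y z \<le> 1 / c"
    using c Phi by (intro divide_left_mono) auto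
  let ?m = "min (dist x y) (min (dist y z) (dist z x))"
  have m: "?m > 0" using xy pos by (auto simp: dist_commute)
  have Psi: "Psi x y z = ereal (dist x y / ?m)"
    using m mx by (auto simp: Psi_def Let_def dist_commute max_def)
  have "K * dist x z \<le> K * dist x y"
    using mx K by (intro mult_left_mono) auto
  then have "dist x y \<le> K * dist x y" using ge(1) by linarith
  then have "dist x y \<le> K * ?m"
    using ge by (auto simp: min_def dist_commute)
  then have m_le: "dist x y / ?m \<le> K" using m by (simp add: divide_le_eq)
  have "s_Phi_Psi p x y z = ereal (s * (1 / Phi p x y z) * (dist x y / ?m))"
    using Phi0 by (simp add: s_Phi_Psi_def s Psi one_ereal_def)
  moreover have "0 \<le> ln 2 / - ln q" using s_le s(2) by linarith
  then have "0 \<le> ln 2 / - ln q * (1 / c)" using c by (intro mult_nonneg_nonneg) auto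
  then have "s * (1 / Phi p x y z) * (dist x y / ?m) \<le> ln 2 / - ln q * (1 / c) * K"
    using s_le P m_le s(2) Phi0 m xy c \<open>0 \<le> ln 2 / - ln q\<close>
    by (intro mult_mono) auto
  ultimately show ?thesis by simp
qed

section \<open>Self-stable families\<close>

text \<open>By Zorn's lemma: self-stability concerns pairs of sequences, and any two members of the union
  of a chain lie in a common member of the chain. A family that is maximal for inclusion is maximal
  in the required sense because every sequence is mutually stable with itself.\<close>

lemma maximal_self_stable_extension:
  assumes "self_stable r A"
  obtains F where "maximal_self_stable r F" "A \<subseteq> F"
proof -
  have "\<exists>F\<in>{F. self_stable r F \<and> A \<subseteq> F}. \<forall>G\<in>{F. self_stable r F \<and> A \<subseteq> F}. F \<subseteq> G \<longrightarrow> G = F"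
  proof (rule subset_Zorn_nonempty)
    show "{F. self_stable r F \<and> A \<subseteq> F} \<noteq> {}" using assms by auto
  next
    fix C assume ne: "C \<noteq> {}" and ch: "subset.chain {F. self_stable r F \<and> A \<subseteq> F} C"
    have "mutually_stable r x y" if xy: "x \<in> \<Union>C" "y \<in> \<Union>C" for x y
    proof -
      obtain G H where "G \<in> C" "x \<in> G" "H \<in> C" "y \<in> H" using xy by blast
      moreover from this have "G \<subseteq> H \<or> H \<subseteq> G" "self_stable r G" "self_stable r H"
        using ch by (auto simp: subset_chain_def)
      ultimately show ?thesis unfolding self_stable_def by blast
    qed
    moreover have "A \<subseteq> \<Union>C" using ne ch unfolding subset_chain_def by blast
    ultimately show "\<Union>C \<in> {F. self_stable r F \<and> A \<subseteq> F}" by (auto simp: self_stable_def)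
  qed
  then obtain F where F: "self_stable r F" "A \<subseteq> F"
    and mx: "\<And>G. self_stable r G \<Longrightarrow> F \<subseteq> G \<Longrightarrow> G = F" by auto
  have "\<exists>x\<in>F. \<not> mutually_stable r x z" if z: "z \<notin> F" for z
  proof (rule ccontr)
    assume "\<not> ?thesis"
    then have st: "mutually_stable r x z" "mutually_stable r z x" if "x \<in> F" for x
      using that by (auto simp: mutually_stable_def dist_commute)
    have "mutually_stable r z z" by (simp add: mutually_stable_def convergent_const)
    with st F(1) have "self_stable r (insert z F)" by (auto simp: self_stable_def)
    from mx[OF this] z show False by auto
  qed
  with F that show thesis by (auto simp: maximal_self_stable_def)
qed

lemma common_convergent_subsequence:
  fixes f :: "'i \<Rightarrow> nat \<Rightarrow> 'b::heine_borel"
  assumes "finite I" "\<And>i. i \<in> I \<Longrightarrow> bounded (range (f i))"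
  shows "\<exists>g::nat \<Rightarrow> nat. strict_mono g \<and> (\<forall>i\<in>I. convergent (f i \<circ> g))"
  using assms
proof (induction I)
  case empty
  show ?case by (rule exI[of _ id]) (auto simp: strict_mono_def)
next
  case (insert j I)
  then obtain g :: "nat \<Rightarrow> nat" where g: "strict_mono g" "\<And>i. i \<in> I \<Longrightarrow> convergent (f i \<circ> g)"
    by blast
  have "bounded (range (f j \<circ> g))"
    using insert.prems[of j] by (auto intro: bounded_subset)
  then obtain l h where h: "strict_mono h" "((f j \<circ> g) \<circ> h) \<longlonglongrightarrow> l"
    using bounded_imp_convergent_subsequence by blast
  have "convergent (f i \<circ> (g \<circ> h))" if "i \<in> insert j I" for i
  proof (cases "i = j")
    case True
    then show ?thesis using h(2) by (auto simp: convergent_def o_assoc)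
  next
    case False
    with that have "convergent (f i \<circ> g)" using g(2) by blast
    then have "convergent ((f i \<circ> g) \<circ> h)"
      using h(1) by (rule convergent_subseq_convergent)
    then show ?thesis by (simp add: o_assoc)
  qed
  then show ?case using g(1) h(1) by (blast intro: strict_mono_o)
qed

text \<open>Bounded rescaled distances to \<open>p\<close> bound all mutual rescaled distances, and there are only
  finitely many pairs to make convergent.\<close>

lemma self_stable_subsequence:
  fixes A :: "(nat \<Rightarrow> 'a::metric_space) set"
  assumes fin: "finite A" and pos: "\<And>n. 0 < r n" and le: "\<And>x n. x \<in> A \<Longrightarrow> dist (x n) p \<le> C * r n"
  obtains g :: "nat \<Rightarrow> nat" where "strict_mono g" "self_stable (r \<circ> g) ((\<lambda>x. x \<circ> g) ` A)"
proof -
  define f where "f = (\<lambda>(x :: nat \<Rightarrow> 'a, y) n. dist (x n) (y n) / r n)"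
  have "bounded (range (f i))" if i: "i \<in> A \<times> A" for i
  proof -
    obtain x y where xy: "i = (x, y)" "x \<in> A" "y \<in> A" using i by auto
    have "norm (f i n) \<le> 2 * C" for n
    proof -
      have "dist (x n) (y n) \<le> 2 * C * r n"
        using dist_triangle2[of "x n" "y n" p] le[OF xy(2), of n] le[OF xy(3), of n] by linarith
      then show ?thesis using pos[of n] by (simp add: f_def xy(1) divide_le_eq)
    qed
    then show ?thesis by (auto intro!: boundedI)
  qed
  then obtain g :: "nat \<Rightarrow> nat" where g: "strict_mono g" "\<And>i. i \<in> A \<times> A \<Longrightarrow> convergent (f i \<circ> g)"
    using common_convergent_subsequence[of "A \<times> A" f] fin by blast
  have "self_stable (r \<circ> g) ((\<lambda>x. x \<circ> g) ` A)"
    using g(2) by (fastforce simp: self_stable_def mutually_stable_def f_def o_def)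
  with g(1) show thesis by (rule that)
qed

text \<open>Passage from equivalence classes to representatives, so that the rest of the argument deals with
  limits of sequences only.\<close>

lemma ultrametric_pretangent_iff:
  assumes nr: "normalizing r" and st: "self_stable r F"
  shows "ultrametric_space (pretangent_space r F) (pretangent_dist r F) \<longleftrightarrow>
    (\<forall>x\<in>F. \<forall>y\<in>F. \<forall>z\<in>F. scaled_dist r x y \<le> max (scaled_dist r x z) (scaled_dist r z y))"
    (is "?U \<longleftrightarrow> ?S")
proof -
  note eq = equiv_pretangent_rel[OF nr st]
  note val = pretangent_dist_eq[OF nr st]
  show ?thesis
  proof
    assume U: ?U
    show ?S
    proof (intro ballI)
      fix x y z assume xyz: "x \<in> F" "y \<in> F" "z \<in> F"
      let ?cl = "\<lambda>u. pretangent_rel r F `` {u}"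
      have cl: "?cl u \<in> pretangent_space r F" if "u \<in> F" for u
        using that unfolding pretangent_space_def by (rule quotientI)
      have self: "u \<in> ?cl u" if "u \<in> F" for u
        using that by (rule equiv_class_self[OF eq])
      have D: "pretangent_dist r F (?cl u) (?cl v) = scaled_dist r u v" if "u \<in> F" "v \<in> F" for u v
        using that by (intro val cl self)
      have "pretangent_dist r F (?cl x) (?cl y)
          \<le> max (pretangent_dist r F (?cl x) (?cl z)) (pretangent_dist r F (?cl y) (?cl z))"
        using U cl xyz unfolding ultrametric_space_def by blast
      then show "scaled_dist r x y \<le> max (scaled_dist r x z) (scaled_dist r z y)"
        using xyz by (simp add: D scaled_dist_commute[of r z y])
    qed
  next
    assume S: ?S
    have rep: "\<exists>x. x \<in> \<alpha> \<and> x \<in> F" if "\<alpha> \<in> pretangent_space r F" for \<alpha>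
      using in_quotient_imp_non_empty[OF eq, of \<alpha>] in_quotient_imp_subset[OF eq, of \<alpha>] that
      unfolding pretangent_space_def by blast
    have "pretangent_dist r F \<alpha> \<beta> \<le> max (pretangent_dist r F \<alpha> \<gamma>) (pretangent_dist r F \<beta> \<gamma>)"
      if abc: "\<alpha> \<in> pretangent_space r F" "\<beta> \<in> pretangent_space r F" "\<gamma> \<in> pretangent_space r F"
      for \<alpha> \<beta> \<gamma>
    proof -
      obtain x y z where xyz: "x \<in> \<alpha>" "x \<in> F" "y \<in> \<beta>" "y \<in> F" "z \<in> \<gamma>" "z \<in> F"
        using rep[OF abc(1)] rep[OF abc(2)] rep[OF abc(3)] by blast
      then have "scaled_dist r x y \<le> max (scaled_dist r x z) (scaled_dist r y z)"
        using S scaled_dist_commute[of r z y] by metis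
      then show ?thesis
        using abc xyz val[of \<alpha> \<beta> x y] val[of \<alpha> \<gamma> x z] val[of \<beta> \<gamma> y z] by simp
    qed
    then show ?U
      using Metric_space_pretangent[OF nr st] by (simp add: ultrametric_space_def)
  qed
qed

section \<open>The equivalence\<close>

text \<open>The normalizing sequence is \<open>d(x\<^sub>n, y\<^sub>n)\<close> itself, along triples of bounded product tending
  to \<open>p\<close>; then \<open>x\<close> and \<open>y\<close> are at distance exactly 1 in the limit.\<close>

lemma ultrametric_imp_large_product:
  fixes p :: "'a::metric_space"
  assumes ultra: "\<And>r F. normalizing r \<Longrightarrow> maximal_self_stable r F \<Longrightarrow> (\<lambda>_. p) \<in> F \<Longrightarrow>
      ultrametric_space (pretangent_space r F) (pretangent_dist r F)"
    and M: "M > 0"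
  shows "\<exists>\<epsilon>>0. \<forall>x y z. dist x p < \<epsilon> \<and> dist y p < \<epsilon> \<and> dist z p < \<epsilon> \<longrightarrow> ereal M < s_Phi_Psi p x y z"
proof (rule ccontr)
  assume "\<not> ?thesis"
  then have "\<exists>x y z. dist x p < e \<and> dist y p < e \<and> dist z p < e \<and> s_Phi_Psi p x y z \<le> ereal M"
    if "e > 0" for e
    using that by (force simp: not_less)
  from this[of "inverse (real (Suc n))" for n]
  have "\<forall>n. \<exists>x y z. dist x p < inverse (real (Suc n)) \<and> dist y p < inverse (real (Suc n)) \<and>
      dist z p < inverse (real (Suc n)) \<and> s_Phi_Psi p x y z \<le> ereal M" by auto
  then obtain x y z where
    near: "\<And>n. dist (x n) p < inverse (real (Suc n))" "\<And>n. dist (y n) p < inverse (real (Suc n))"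
    and small: "\<And>n. s_Phi_Psi p (x n) (y n) (z n) \<le> ereal M"
    by metis
  obtain q where q: "q < 1" and "\<And>p x y z :: 'a. s_Phi_Psi p x y z \<le> ereal M \<Longrightarrow>
      0 < dist x y \<and> dist x z \<le> q * dist x y \<and> dist z y \<le> q * dist x y \<and>
      dist x p \<le> (M + 1) * dist x y \<and> dist y p \<le> (M + 1) * dist x y \<and>
      dist z p \<le> (M + 1) * dist x y"
    using bounded_product_imp_scalene[of M] by blast
  from this(2)[OF small]
  have pos: "\<And>n. 0 < dist (x n) (y n)"
    and le: "\<And>n. dist (x n) (z n) \<le> q * dist (x n) (y n)" "\<And>n. dist (z n) (y n) \<le> q * dist (x n) (y n)"
    and C: "\<And>n. dist (x n) p \<le> (M + 1) * dist (x n) (y n)"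
      "\<And>n. dist (y n) p \<le> (M + 1) * dist (x n) (y n)"
      "\<And>n. dist (z n) p \<le> (M + 1) * dist (x n) (y n)"
    by blast+
  define r where "r = (\<lambda>n. dist (x n) (y n))"
  have "(\<lambda>n. 2 * inverse (real (Suc n))) \<longlonglongrightarrow> 2 * 0"
    by (intro tendsto_mult tendsto_const LIMSEQ_inverse_real_of_nat)
  moreover have "r n \<le> 2 * inverse (real (Suc n))" for n
    unfolding r_def using dist_triangle2[of "x n" "y n" p] near[of n] by linarith
  ultimately have r0: "r \<longlonglongrightarrow> 0"
    by (intro tendsto_sandwich[of "\<lambda>_. 0" r sequentially "\<lambda>n. 2 * inverse (real (Suc n))" 0])
      (auto simp: r_def)
  obtain g :: "nat \<Rightarrow> nat" where g: "strict_mono g"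
    and st: "self_stable (r \<circ> g) ((\<lambda>u. u \<circ> g) ` {x, y, z, \<lambda>_. p})"
  proof (rule self_stable_subsequence[of "{x, y, z, \<lambda>_. p}" r p "M + 1"])
    show "dist (u n) p \<le> (M + 1) * r n" if "u \<in> {x, y, z, \<lambda>_. p}" for u n
      using that C M pos[of n] by (auto simp: r_def)
  qed (use pos in \<open>auto simp: r_def\<close>)
  have nr: "normalizing (r \<circ> g)"
    using pos LIMSEQ_subseq_LIMSEQ[OF r0 g] by (auto simp: normalizing_def r_def)
  obtain F where F: "maximal_self_stable (r \<circ> g) F" "(\<lambda>u. u \<circ> g) ` {x, y, z, \<lambda>_. p} \<subseteq> F"
    by (rule maximal_self_stable_extension[OF st])
  then have sF: "self_stable (r \<circ> g) F" by (simp add: maximal_self_stable_def)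
  have mem: "x \<circ> g \<in> F" "y \<circ> g \<in> F" "z \<circ> g \<in> F" "(\<lambda>_. p) \<in> F"
    using F(2) by (auto simp: o_def)
  define D :: "(nat \<Rightarrow> 'a) \<Rightarrow> (nat \<Rightarrow> 'a) \<Rightarrow> real" where "D = scaled_dist (r \<circ> g)"
  note lim = scaled_dist_tendsto[OF sF, folded D_def]
  have "D (x \<circ> g) (y \<circ> g) \<le> max (D (x \<circ> g) (z \<circ> g)) (D (z \<circ> g) (y \<circ> g))"
    using ultra[OF nr F(1) mem(4)] mem unfolding ultrametric_pretangent_iff[OF nr sF] D_def by blast
  moreover have "D (x \<circ> g) (y \<circ> g) = 1"
  proof (rule LIMSEQ_unique[OF lim[OF mem(1,2)]])
    have "dist ((x \<circ> g) n) ((y \<circ> g) n) / (r \<circ> g) n = 1" for n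
      using pos[of "g n"] by (simp add: r_def)
    then show "(\<lambda>n. dist ((x \<circ> g) n) ((y \<circ> g) n) / (r \<circ> g) n) \<longlonglongrightarrow> 1"
      by (simp only: tendsto_const)
  qed
  moreover have "D (x \<circ> g) (z \<circ> g) \<le> q"
    by (rule LIMSEQ_le_const2[OF lim[OF mem(1,3)]]) (use pos le in \<open>auto simp: r_def divide_le_eq\<close>)
  moreover have "D (z \<circ> g) (y \<circ> g) \<le> q"
    by (rule LIMSEQ_le_const2[OF lim[OF mem(3,2)]]) (use pos le in \<open>auto simp: r_def divide_le_eq\<close>)
  ultimately show False using q by linarith
qed

text \<open>\<open>F\<close> is invariant under scaling of the metric, so it can be evaluated on the rescaled
  distances, whose limits are known. At \<open>x = y = p\<close> both sides are 0, the right one because \<open>0 / 0 = 0\<close>.\<close>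

lemma F_fun_scaled:
  assumes "0 < r"
  shows "F_fun p x y = (dist x y / r) * min (dist x p / r) (dist y p / r) /
    (max (dist x p / r) (dist y p / r))\<^sup>2"
proof -
  have "min (dist x p / r) (dist y p / r) = min (dist x p) (dist y p) / r"
    "max (dist x p / r) (dist y p / r) = max (dist x p) (dist y p) / r"
    using assms by (auto simp: min_def max_def divide_le_cancel)
  then show ?thesis using assms by (auto simp: F_fun_def power2_eq_square)
qed

lemma F_fun_tendsto:
  assumes nr: "normalizing r" and st: "self_stable r F" and mem: "x \<in> F" "y \<in> F" "(\<lambda>_. p) \<in> F"
    and pos: "0 < scaled_dist r x y" "0 < scaled_dist r x (\<lambda>_. p)" "0 < scaled_dist r y (\<lambda>_. p)"
  obtains L where "0 < L" "(\<lambda>n. F_fun p (x n) (y n)) \<longlonglongrightarrow> L"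
proof
  let ?X = "scaled_dist r x (\<lambda>_. p)" and ?Y = "scaled_dist r y (\<lambda>_. p)"
  note lim = scaled_dist_tendsto[OF st]
  show "0 < scaled_dist r x y * min ?X ?Y / (max ?X ?Y)\<^sup>2"
    using pos by (intro divide_pos_pos mult_pos_pos zero_less_power) auto
  have "max ?X ?Y \<noteq> 0" using pos by (auto simp: max_def)
  then have "(\<lambda>n. (dist (x n) (y n) / r n) * min (dist (x n) p / r n) (dist (y n) p / r n) /
      (max (dist (x n) p / r n) (dist (y n) p / r n))\<^sup>2) \<longlonglongrightarrow>
      scaled_dist r x y * min ?X ?Y / (max ?X ?Y)\<^sup>2"
    by (intro tendsto_divide tendsto_mult tendsto_min tendsto_max tendsto_power lim mem) auto
  moreover have "F_fun p (x n) (y n) = (dist (x n) (y n) / r n) *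
      min (dist (x n) p / r n) (dist (y n) p / r n) /
      (max (dist (x n) p / r n) (dist (y n) p / r n))\<^sup>2" for n
    using nr by (intro F_fun_scaled) (auto simp: normalizing_def)
  ultimately show "(\<lambda>n. F_fun p (x n) (y n)) \<longlonglongrightarrow> scaled_dist r x y * min ?X ?Y / (max ?X ?Y)\<^sup>2"
    by simp
qed

text \<open>Three points at positive mutual distance cannot have two of them at distance 0 from \<open>p\<close>. So
  some pair is apart from \<open>p\<close>, and \<open>F\<close> on this pair tends to a positive limit.\<close>

lemma Phi_eventually_ge:
  assumes nr: "normalizing r" and st: "self_stable r F"
    and mem: "x \<in> F" "y \<in> F" "z \<in> F" "(\<lambda>_. p) \<in> F"
    and pos: "0 < scaled_dist r x y" "0 < scaled_dist r x z" "0 < scaled_dist r y z"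
  obtains c where "0 < c" "\<forall>\<^sub>F n in sequentially. c \<le> Phi p (x n) (y n) (z n)"
proof -
  note thesisI = that
  let ?D = "\<lambda>u. scaled_dist r u (\<lambda>_. p)"
  have nn: "0 \<le> ?D u" if "u \<in> F" for u
    using that mem by (intro scaled_dist_nonneg[OF nr st])
  have apart: "0 < ?D u \<or> 0 < ?D v" if "u \<in> F" "v \<in> F" "0 < scaled_dist r u v" for u v
    using scaled_dist_triangle[OF nr st that(1) mem(4) that(2)] nn[OF that(1)] nn[OF that(2)] that(3)
      scaled_dist_commute[of r "\<lambda>_. p" v] by linarith
  have conclude: thesis
    if uv: "u \<in> F" "v \<in> F" "0 < scaled_dist r u v" "0 < ?D u" "0 < ?D v"
      and le: "\<And>n. F_fun p (u n) (v n) \<le> Phi p (x n) (y n) (z n)" for u v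
  proof -
    obtain L where L: "0 < L" "(\<lambda>n. F_fun p (u n) (v n)) \<longlonglongrightarrow> L"
      using F_fun_tendsto[OF nr st uv(1,2) mem(4) uv(3-5)] .
    have "\<forall>\<^sub>F n in sequentially. L / 2 < F_fun p (u n) (v n)"
      using L by (intro order_tendstoD(1)) auto
    then have "\<forall>\<^sub>F n in sequentially. L / 2 \<le> Phi p (x n) (y n) (z n)"
      by eventually_elim (use le in \<open>smt (verit)\<close>)
    with L(1) show thesis by (intro thesisI[of "L / 2"]) auto
  qed
  consider "0 < ?D x" "0 < ?D y" | "0 < ?D x" "0 < ?D z" | "0 < ?D y" "0 < ?D z"
    using apart[OF mem(1,2) pos(1)] apart[OF mem(1,3) pos(2)] apart[OF mem(2,3) pos(3)] by blast
  then show thesis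
  proof cases
    case 1
    then show ?thesis using mem pos by (intro conclude[of x y]) (auto simp: Phi_def)
  next
    case 2
    then show ?thesis using mem pos by (intro conclude[of x z]) (auto simp: Phi_def)
  next
    case 3
    then show ?thesis using mem pos by (intro conclude[of y z]) (auto simp: Phi_def)
  qed
qed

lemma tendsto_of_scaled:
  assumes nr: "normalizing r" and st: "self_stable r F" and mem: "u \<in> F" "(\<lambda>_. p) \<in> F"
  shows "(\<lambda>n. dist (u n) p) \<longlonglongrightarrow> 0"
proof -
  have "(\<lambda>n. dist (u n) p / r n * r n) \<longlonglongrightarrow> scaled_dist r u (\<lambda>_. p) * 0"
    using nr by (intro tendsto_mult scaled_dist_tendsto[OF st] mem) (auto simp: normalizing_def)
  moreover have "r n \<noteq> 0" for n using nr by (auto simp: normalizing_def less_le)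
  ultimately show ?thesis by simp
qed

text \<open>A violation of the strong triangle inequality in the limit turns into the hypotheses of
  \<open>scalene_imp_bounded_product\<close> for all large indices, with constants \<open>q\<close> and \<open>K\<close> chosen
  strictly beyond the limiting ratios.\<close>

lemma large_product_imp_ultrametric:
  fixes p :: "'a::metric_space"
  assumes large: "\<And>M::real. M > 0 \<Longrightarrow> \<exists>\<epsilon>>0. \<forall>x y z. dist x p < \<epsilon> \<and> dist y p < \<epsilon> \<and> dist z p < \<epsilon> \<longrightarrow>
      ereal M < s_Phi_Psi p x y z"
    and nr: "normalizing r" and st: "self_stable r F" and p: "(\<lambda>_. p) \<in> F"
  shows "ultrametric_space (pretangent_space r F) (pretangent_dist r F)"
  unfolding ultrametric_pretangent_iff[OF nr st]
proof (intro ballI, rule ccontr)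
  fix x y z :: "nat \<Rightarrow> 'a" assume mem: "x \<in> F" "y \<in> F" "z \<in> F"
  define D :: "(nat \<Rightarrow> 'a) \<Rightarrow> (nat \<Rightarrow> 'a) \<Rightarrow> real" where "D = scaled_dist r"
  note lim = scaled_dist_tendsto[OF st, folded D_def]
  note tri = scaled_dist_triangle[OF nr st, folded D_def]
  assume "\<not> scaled_dist r x y \<le> max (scaled_dist r x z) (scaled_dist r z y)"
  then have lt: "D x z < D x y" "D z y < D x y" by (auto simp: D_def)
  \<comment> \<open>If a shorter side vanished, the ordinary triangle inequality would make the other two equal.\<close>
  then have pos: "0 < D x z" "0 < D z y" "0 < D x y"
    using tri[of x z y] scaled_dist_nonneg[OF nr st, folded D_def, of x z] mem by auto
  have lims: "(\<lambda>n. dist (x n) (y n) / r n) \<longlonglongrightarrow> D x y" "(\<lambda>n. dist (x n) (z n) / r n) \<longlonglongrightarrow> D x z"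
    "(\<lambda>n. dist (z n) (y n) / r n) \<longlonglongrightarrow> D z y"
    using mem by (auto intro: lim)
  have "max (D x z / D x y) (D z y / D x y) < 1"
    using lt pos by simp
  then obtain q where "max (D x z / D x y) (D z y / D x y) < q" and q1: "q < 1"
    using dense by blast
  then have q: "D x z < q * D x y" "D z y < q * D x y"
    using pos by (auto simp: divide_less_eq)
  obtain K where "max (D x y / D x z) (D x y / D z y) < K"
    using gt_ex by blast
  moreover from this have "0 < K"
    using pos by (smt (verit) divide_pos_pos max.cobounded1)
  ultimately have K: "0 < K" "D x y < K * D x z" "D x y < K * D z y"
    using pos by (auto simp: divide_less_eq)
  obtain c where c: "0 < c" "\<forall>\<^sub>F n in sequentially. c \<le> Phi p (x n) (y n) (z n)"
    using Phi_eventually_ge[OF nr st mem p] pos by (auto simp: D_def scaled_dist_commute[of r z y])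
  have rpos: "0 < r n" for n using nr by (simp add: normalizing_def)
  have ev: "\<forall>\<^sub>F n in sequentially. f n < a * h n"
    if "(\<lambda>n. f n / r n) \<longlonglongrightarrow> A" "(\<lambda>n. h n / r n) \<longlonglongrightarrow> B" "A < a * B" for f h :: "nat \<Rightarrow> real" and a A B
  proof -
    have "(\<lambda>n. f n / r n - a * (h n / r n)) \<longlonglongrightarrow> A - a * B"
      by (intro tendsto_intros that)
    then have "\<forall>\<^sub>F n in sequentially. f n / r n - a * (h n / r n) < 0"
      using that(3) by (intro order_tendstoD(2)) auto
    then show ?thesis
    proof eventually_elim
      case (elim n)
      then show ?case using rpos[of n] by (simp add: field_simps)
    qed
  qed
  have ev0: "\<forall>\<^sub>F n in sequentially. 0 < f n"
    if "(\<lambda>n. f n / r n) \<longlonglongrightarrow> A" "0 < A" for f :: "nat \<Rightarrow> real" and A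
  proof -
    have "\<forall>\<^sub>F n in sequentially. 0 < f n / r n"
      by (rule order_tendstoD(1)[OF that])
    then show ?thesis
    proof eventually_elim
      case (elim n)
      then show ?case using rpos[of n] by (simp add: zero_less_divide_iff)
    qed
  qed
  define B where "B = ln 2 / - ln q * (1 / c) * K"
  have small: "\<forall>\<^sub>F n in sequentially. s_Phi_Psi p (x n) (y n) (z n) \<le> ereal B"
    using c(2) ev0[OF lims(2) pos(1)] ev0[OF lims(3) pos(2)]
      ev[OF lims(2,1) q(1)] ev[OF lims(3,1) q(2)] ev[OF lims(1,2) K(2)] ev[OF lims(1,3) K(3)]
  proof eventually_elim
    case (elim n)
    then show ?case
      unfolding B_def using q1 c(1) K(1) by (intro scalene_imp_bounded_product) auto
  qed
  obtain e where e: "e > 0"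
    "\<And>x y z. dist x p < e \<Longrightarrow> dist y p < e \<Longrightarrow> dist z p < e \<Longrightarrow> ereal (max B 1) < s_Phi_Psi p x y z"
    using large[of "max B 1"] less_max_iff_disj[of 0 B 1] zero_less_one by metis
  have near: "\<forall>\<^sub>F n in sequentially. dist (u n) p < e" if "u \<in> F" for u
    using tendsto_of_scaled[OF nr st that p] e(1) by (rule order_tendstoD)
  have "\<forall>\<^sub>F n in sequentially. False"
    using small near[OF mem(1)] near[OF mem(2)] near[OF mem(3)]
  proof eventually_elim
    case (elim n)
    then have "ereal (max B 1) < ereal B"
      using e(2) by (meson less_le_trans)
    then show False by simp
  qed
  then show False by simp
qed

theorem theorem2p9:
  fixes p :: "'a::metric_space"
  shows "(\<forall>r F. normalizing r \<and> maximal_self_stable r F \<and> (\<lambda>_. p) \<in> F \<longrightarrow>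
            ultrametric_space (pretangent_space r F) (pretangent_dist r F)) \<longleftrightarrow>
         (\<forall>M::real. M > 0 \<longrightarrow> (\<exists>\<epsilon>>0. \<forall>x y z. dist x p < \<epsilon> \<and> dist y p < \<epsilon> \<and> dist z p < \<epsilon> \<longrightarrow>
            ereal M < s_Phi_Psi p x y z))"
    (is "?ultra \<longleftrightarrow> ?large")
proof
  assume ?ultra
  then show ?large
    by (intro allI impI ultrametric_imp_large_product) blast+
next
  assume large: ?large
  show ?ultra
  proof (intro allI impI)
    fix r F assume "normalizing r \<and> maximal_self_stable r F \<and> (\<lambda>_. p) \<in> F"
    then show "ultrametric_space (pretangent_space r F) (pretangent_dist r F)"
      using large by (intro large_product_imp_ultrametric[of p]) (auto simp: maximal_self_stable_def)
  qed
qed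

end
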